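(* Let $q$ be a complex number with $|q|<1$ and let $k,m$ be positive integers with $m\ge k$. Then, for each choice of sign (upper signs throughout, or lower signs throughout), \begin{align*} A_{k,m}^{\pm}(q)&=\frac{1}{(\pm q;q)_m^2}\sum_{i=0}^{m-k}\sum_{j=i+k}^m(\mp 1)^{j-i-k}\frac{j-i}{k}{j-i+k-1\choose 2k-1}{m\brack i}_q{m\brack j}_q q^{\frac{i(i+1)}{2}+\frac{j(j+1)}{2}},\\ C_{k,m}^{\pm}(q)&=\frac{1}{(\pm q;q^2)_m^2}\sum_{i=0}^{m-k}\sum_{j=i+k}^m(\mp 1)^{j-i-k}\frac{j-i}{k}{j-i+k-1\choose 2k-1}{m\brack i}_{q^2}{m\brack j}_{q^2} q^{i^2+j^2}. \end{align*}
   Context: The $q$-shifted factorial is $(a;q)_0=1$ and $(a;q)_n=(1-a)(1-aq)\cdots(1-aq^{n-1})$ for $n\ge1$. The $q$-binomial coefficient is ${n\brack k}_q=\frac{(q;q)_n}{(q;q)_k(q;q)_{n-k}}$ if $0\le k\le n$ and $0$ otherwise; ${n\brack k}_{q^2}$ is the same with $q$ replaced by $q^2$. The truncated MacMahon $q$-series are \[ A_{k,m}^{\pm}(q)=\sum_{1\le \lambda_1<\lambda_2<\cdots<\lambda_k\le m}\frac{q^{\lambda_1+\lambda_2+\cdots+\lambda_k}}{(1\mp q^{\lambda_1})^2 (1\mp q^{\lambda_2})^2\cdots (1\mp q^{\lambda_k})^2}, \] \[ C_{k,m}^{\pm}(q)=\sum_{1\le \lambda_1<\lambda_2<\cdots<\lambda_k\le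 m}\frac{q^{2\lambda_1+2\lambda_2+\cdots+2\lambda_k-k}}{(1\mp q^{2\lambda_1-1})^2 (1\mp q^{2\lambda_2-1})^2\cdots (1\mp q^{2\lambda_k-1})^2}, \] where the sums range over integers $\lambda_1,\dots,\lambda_k$. *)

theory Defs
  imports Complex_Main
begin

definition qpochhammer :: "complex \<Rightarrow> complex \<Rightarrow> nat \<Rightarrow> complex" where
  "qpochhammer a q n = (\<Prod>i<n. 1 - a * q ^ i)"

definition qbinomial :: "complex \<Rightarrow> nat \<Rightarrow> nat \<Rightarrow> complex" where
  "qbinomial q n k =
     (if k \<le> n
      then qpochhammer q q n / (qpochhammer q q k * qpochhammer q q (n - k))
      else 0)"

(* A tuple (lambda_1, ..., lambda_k) with 1 <= lambda_1 < ... < lambda_k <= m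
   is represented by the list of its entries. *)
definition increasing_tuples :: "nat \<Rightarrow> nat \<Rightarrow> nat list set" where
  "increasing_tuples k m =
     {ls. length ls = k \<and> sorted_wrt (<) ls \<and> (\<forall>l\<in>set ls. 1 \<le> l \<and> l \<le> m)}"

lemma finite_increasing_tuples: "finite (increasing_tuples k m)"
  by (rule finite_subset[OF _ finite_lists_length_eq[of "{1..m}" k]])
     (auto simp: increasing_tuples_def)

(* The parameter s is the sign: s = 1 is the upper sign (A^+, C^+, with factors
   1 - q^l in the denominator), s = -1 the lower one (A^-, C^-, factors 1 + q^l). *)
definition macmahon_A :: "complex \<Rightarrow> nat \<Rightarrow> nat \<Rightarrow> complex \<Rightarrow> complex" where
  "macmahon_A s k m q =
     (\<Sum>ls\<in>increasing_tuples k m.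
        q ^ sum_list ls / (\<Prod>l\<leftarrow>ls. (1 - s * q ^ l)\<^sup>2))"

(* All entries are at least 1, so neither subtraction in nat truncates. *)
definition macmahon_C :: "complex \<Rightarrow> nat \<Rightarrow> nat \<Rightarrow> complex \<Rightarrow> complex" where
  "macmahon_C s k m q =
     (\<Sum>ls\<in>increasing_tuples k m.
        q ^ ((\<Sum>l\<leftarrow>ls. 2 * l) - k) / (\<Prod>l\<leftarrow>ls. (1 - s * q ^ (2 * l - 1))\<^sup>2))"

end

theory Submission
  imports Defs
begin

text \<open>
  Let \<open>y\<^sub>l\<close> be \<open>q ^ l\<close> (for \<open>A\<close>) or \<open>q ^ (2 * l - 1)\<close> (for \<open>C\<close>).  The truncated series are the
  elementary symmetric functions of the numbers \<open>y\<^sub>l / (1 - s * y\<^sub>l)\<^sup>2\<close>, i.e. the coefficients of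
  \<open>\<Prod>l. 1 + x * y\<^sub>l / (1 - s * y\<^sub>l)\<^sup>2\<close>.  Substituting \<open>x = z + 1/z + 2 * s\<close> turns the numerator of
  each factor into \<open>(1 + z * y\<^sub>l) * (1 + y\<^sub>l / z)\<close>, so that two applications of the \<open>q\<close>-binomial
  theorem expand the product as a double sum, symmetric in \<open>z\<close> and \<open>1/z\<close>.  Expanding
  \<open>z ^ n + 1/z ^ n\<close> in powers of \<open>x\<close> and comparing coefficients gives both identities.
\<close>

section \<open>Increasing tuples and elementary symmetric functions\<close>

lemma sum_increasing_tuples:
  fixes f :: "nat \<Rightarrow> 'a::comm_semiring_1"
  shows "(\<Sum>ls\<in>increasing_tuples k m. \<Prod>l\<leftarrow>ls. f l) = (\<Sum>S | S \<subseteq> {1..m} \<and> card S = k. \<Prod>l\<in>S. f l)"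
proof (rule sum.reindex_bij_witness[where i = sorted_list_of_set and j = set])
  fix ls assume ls: "ls \<in> increasing_tuples k m"
  then have *: "sorted ls" "distinct ls"
    by (auto simp: increasing_tuples_def strict_sorted_iff)
  show "sorted_list_of_set (set ls) = ls"
    using * by (simp add: sorted_list_of_set.idem_if_sorted_distinct)
  show "set ls \<in> {S. S \<subseteq> {1..m} \<and> card S = k}"
    using ls * by (auto simp: increasing_tuples_def distinct_card)
  show "(\<Prod>l\<in>set ls. f l) = (\<Prod>l\<leftarrow>ls. f l)"
    using * by (simp add: prod.distinct_set_conv_list)
next
  fix S assume S: "S \<in> {S. S \<subseteq> {1..m} \<and> card S = k}"
  then have fin: "finite S"
    using finite_subset by blast
  then show "set (sorted_list_of_set S) = S"
    by simp
  show "sorted_list_of_set S \<in> increasing_tuples k m"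
    using S fin by (auto simp: increasing_tuples_def)
qed

text \<open>Expanding the product chooses a subset of \<open>{1..m}\<close>, and grouping the
  subsets by cardinality collects the powers of \<open>x\<close>. This generating function gives
  access to the truncated series as coefficients.\<close>

lemma prod_one_plus_increasing_tuples:
  fixes f :: "nat \<Rightarrow> 'a::comm_ring_1"
  shows "(\<Prod>l=1..m. 1 + x * f l) = (\<Sum>k\<le>m. (\<Sum>ls\<in>increasing_tuples k m. \<Prod>l\<leftarrow>ls. f l) * x ^ k)"
proof -
  have "(\<Prod>l=1..m. 1 + x * f l) = (\<Prod>l=1..m. x * f l + 1)"
    by (simp add: add.commute)
  also have "\<dots> = (\<Sum>S\<in>Pow {1..m}. \<Prod>l\<in>S. x * f l)"
    by (subst prod_add) auto
  also have "\<dots> = (\<Sum>S\<in>Pow {1..m}. (\<Prod>l\<in>S. f l) * x ^ card S)"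
    by (simp add: prod.distrib mult.commute)
  also have "\<dots> = (\<Sum>k\<le>m. \<Sum>S | S \<in> Pow {1..m} \<and> card S = k. (\<Prod>l\<in>S. f l) * x ^ card S)"
  proof (rule sum.group[symmetric])
    show "card ` Pow {1..m} \<subseteq> {..m}"
      using card_mono[of "{1..m}"] by fastforce
  qed auto
  also have "\<dots> = (\<Sum>k\<le>m. (\<Sum>ls\<in>increasing_tuples k m. \<Prod>l\<leftarrow>ls. f l) * x ^ k)"
    by (intro sum.cong refl) (simp add: sum_increasing_tuples sum_distrib_right)
  finally show ?thesis .
qed

section \<open>The q-Pascal rule and the q-binomial theorem\<close>

lemma qpochhammer_Suc: "qpochhammer a q (Suc n) = qpochhammer a q n * (1 - a * q ^ n)"
  by (simp add: qpochhammer_def)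

lemma qpochhammer_nonzero:
  assumes "\<And>n. p ^ Suc n \<noteq> 1"
  shows "qpochhammer p p n \<noteq> 0"
  using assms by (auto simp: qpochhammer_def)

lemma qbinomial_0_right:
  assumes "\<And>n. p ^ Suc n \<noteq> 1"
  shows "qbinomial p m 0 = 1"
  using qpochhammer_nonzero[OF assms, of m] by (simp add: qbinomial_def qpochhammer_def)

text \<open>With m = j + d + 1 and a common factor taken out, the q-Pascal rule reduces to (1 -
  p^(d+1)) + p^(d+1) (1 - p^(j+1)) = 1 - p^(m+1). The hypothesis on \<open>p\<close> keeps all
  denominators nonzero.\<close>

lemma qbinomial_Suc_Suc:
  assumes p: "\<And>n. p ^ Suc n \<noteq> 1" and "j \<le> m"
  shows "qbinomial p (Suc m) (Suc j) = qbinomial p m (Suc j) + p ^ (m - j) * qbinomial p m j"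
\<comment> \<open>For j = m the first summand is 0 by the default value of \<open>qbinomial\<close>,
  not by the quotient formula.\<close>
proof (cases "j = m")
  case True
  then show ?thesis
    using qpochhammer_nonzero[OF p, of m] qpochhammer_nonzero[OF p, of "Suc m"]
    by (simp add: qbinomial_def qpochhammer_def[of _ _ 0])
next
  case False
  with \<open>j \<le> m\<close> obtain d where m: "m = Suc (j + d)"
    by (metis le_neq_implies_less less_iff_Suc_add)
  have nz: "qpochhammer p p n \<noteq> 0" for n
    by (rule qpochhammer_nonzero[OF p])
  have nz': "1 - p * p ^ n \<noteq> 0" for n
    using p[of n] by simp
  let ?Q = "qpochhammer p p"
  have "qbinomial p m (Suc j) + p ^ (m - j) * qbinomial p m j
      = ?Q m / (?Q (Suc j) * ?Q (Suc d)) * ((1 - p * p ^ d) + p ^ Suc d * (1 - p * p ^ j))"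
    using nz[of j] nz[of d] nz'[of j] nz'[of d]
    by (simp add: m qbinomial_def qpochhammer_Suc[of p p j] qpochhammer_Suc[of p p d] Suc_diff_le)
      (simp add: divide_simps, simp add: algebra_simps)
  also have "(1 - p * p ^ d) + p ^ Suc d * (1 - p * p ^ j) = 1 - p * p ^ m"
    by (simp add: m algebra_simps power_add)
  also have "?Q m / (?Q (Suc j) * ?Q (Suc d)) * (1 - p * p ^ m) = qbinomial p (Suc m) (Suc j)"
    by (simp add: m qbinomial_def qpochhammer_Suc[of p p "Suc (j + d)"] Suc_diff_le)
  finally show ?thesis ..
qed

text \<open>Induction on \<open>m\<close>: the q-Pascal rule splits each new coefficient into the
  contributions of 1 and of \<open>z * p ^ m\<close> in the last factor.\<close>

lemma q_binomial_theorem: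
  assumes p: "\<And>n. p ^ Suc n \<noteq> 1"
  shows "(\<Prod>l<m. 1 + z * p ^ l) = (\<Sum>j\<le>m. qbinomial p m j * p ^ (j choose 2) * z ^ j)"
proof (induction m)
  case 0
  then show ?case
    by (simp add: qbinomial_0_right[OF p] choose_two)
next
  case (Suc m)
  let ?t = "\<lambda>m j. qbinomial p m j * p ^ (j choose 2) * z ^ j"
  have step: "?t (Suc m) (Suc j) = ?t m (Suc j) + z * p ^ m * ?t m j" if "j \<le> m" for j
  proof -
    have e: "Suc j choose 2 = (j choose 2) + j"
      by (simp add: numeral_2_eq_2)
    have "p ^ m = p ^ (m - j) * p ^ j"
      using that by (simp flip: power_add)
    then show ?thesis
      by (simp add: qbinomial_Suc_Suc[OF p that] e power_add algebra_simps)
  qed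
  \<comment> \<open>By the default value of \<open>qbinomial\<close>, extending the old sum to the
    index \<open>Suc m\<close> changes nothing.\<close>
  have top: "?t m (Suc m) = 0"
    by (simp add: qbinomial_def)
  have "(\<Sum>j\<le>Suc m. ?t (Suc m) j) = ?t (Suc m) 0 + (\<Sum>j\<le>m. ?t (Suc m) (Suc j))"
    by (rule sum.atMost_Suc_shift)
  also have "(\<Sum>j\<le>m. ?t (Suc m) (Suc j)) = (\<Sum>j\<le>m. ?t m (Suc j)) + z * p ^ m * (\<Sum>j\<le>m. ?t m j)"
    by (simp only: sum_distrib_left sum.distrib[symmetric]) (rule sum.cong[OF refl], rule step, simp)
  also have "?t (Suc m) 0 = ?t m 0"
    by (simp add: qbinomial_0_right[OF p])
  also have "?t m 0 + ((\<Sum>j\<le>m. ?t m (Suc j)) + z * p ^ m * (\<Sum>j\<le>m. ?t m j))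
      = (\<Sum>j\<le>Suc m. ?t m j) + z * p ^ m * (\<Sum>j\<le>m. ?t m j)"
    by (subst sum.atMost_Suc_shift) (simp add: add.assoc)
  also have "(\<Sum>j\<le>Suc m. ?t m j) = (\<Sum>j\<le>m. ?t m j)"
    using top by simp
  finally show ?case
    using Suc by (simp add: algebra_simps)
qed

section \<open>Expansion of t^n + t^(-n) in powers of t + 1/t - 2\<close>

lemma binomial_double_recurrence:
  "((n + 2 + Suc k) choose (2 * Suc k)) + ((n + Suc k) choose (2 * Suc k)) =
   ((n + 1 + k) choose (2 * k)) + 2 * ((n + 1 + Suc k) choose (2 * Suc k))"
  by (simp add: numeral_2_eq_2)

text \<open>The sums \<open>S n\<close> are Morgan-Voyce polynomials. Coefficientwise the recurrence
  says that the second difference in n of binom(n+k+1, 2k+2) is binom(n+k+1, 2k). The common upper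
  bound \<open>N\<close> allows comparison term by term.\<close>

lemma sum_binomial_double_recurrence:
  fixes y :: "'a::comm_ring_1"
  assumes "n + 2 \<le> N"
  defines "S \<equiv> \<lambda>n. \<Sum>k\<le>N. of_nat ((n + k) choose (2 * k)) * y ^ k"
  shows "S (n + 2) = (y + 2) * S (n + 1) - S n"
proof -
  let ?e = "\<lambda>n k. of_nat ((n + k) choose (2 * k)) * y ^ k"
  from assms obtain M where N: "N = Suc M"
    by (cases N) auto
  have S: "S n = 1 + (\<Sum>k\<le>M. ?e n (Suc k))" for n
    unfolding S_def N by (subst sum.atMost_Suc_shift) simp
  have step: "?e (n + 2) (Suc k) + ?e n (Suc k) = y * ?e (n + 1) k + 2 * ?e (n + 1) (Suc k)" for k
  proof -
    have "?e (n + 2) (Suc k) + ?e n (Suc k) =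
        of_nat (((n + 2 + Suc k) choose (2 * Suc k)) + ((n + Suc k) choose (2 * Suc k))) * y ^ Suc k"
      by (simp only: of_nat_add distrib_right)
    also have "\<dots> = y * ?e (n + 1) k + 2 * ?e (n + 1) (Suc k)"
      unfolding binomial_double_recurrence by (simp only: of_nat_add of_nat_mult) (simp add: algebra_simps)
    finally show ?thesis .
  qed
  \<comment> \<open>Since n + 1 < N, the top coefficient of \<open>S (n + 1)\<close> vanishes, so
    multiplying by \<open>y\<close> does not leave the range of summation.\<close>
  have "(n + 1 + N) choose (2 * N) = 0"
    using assms(1) by (intro binomial_eq_0) simp
  then have S': "S (n + 1) = (\<Sum>k\<le>M. ?e (n + 1) k)"
    by (simp only: S_def N sum.atMost_Suc of_nat_0 mult_zero_left add_0_right)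
  have "S (n + 2) + S n = 2 + (\<Sum>k\<le>M. ?e (n + 2) (Suc k) + ?e n (Suc k))"
    unfolding S[of "n + 2"] S[of n] sum.distrib by simp
  also have "\<dots> = 2 + y * S (n + 1) + 2 * (\<Sum>k\<le>M. ?e (n + 1) (Suc k))"
    unfolding step sum.distrib S' by (simp only: sum_distrib_left add.assoc)
  also have "2 * (\<Sum>k\<le>M. ?e (n + 1) (Suc k)) = 2 * S (n + 1) - 2"
    unfolding S[of "n + 1"] by (simp only: distrib_left) simp
  finally show ?thesis
    by (simp add: algebra_simps)
qed

text \<open>For y = t + 1/t - 2 the recurrence of \<open>S\<close> has characteristic roots t and
  1/t. Hence t^n + t^(-n) and S(n) + S(n-1) obey the same recurrence, and they agree for n = 1 and n
  = 2.\<close>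

lemma power_plus_inverse_power:
  fixes t :: "'a::field"
  assumes "t \<noteq> 0" and "1 \<le> n" and "n \<le> N"
  shows "t ^ n + inverse t ^ n =
    (\<Sum>k\<le>N. (of_nat ((n + k) choose (2 * k)) + of_nat ((n - 1 + k) choose (2 * k))) * (t + inverse t - 2) ^ k)"
proof -
  define y where "y = t + inverse t - 2"
  define S where "S = (\<lambda>n. \<Sum>k\<le>N. of_nat ((n + k) choose (2 * k)) * y ^ k)"
  have rec: "S (n + 2) = (y + 2) * S (n + 1) - S n" if "n + 2 \<le> N" for n
    unfolding S_def by (rule sum_binomial_double_recurrence[OF that])
  have zero: "i \<le> n" if "of_nat ((n + i) choose (2 * i)) \<noteq> (0 :: 'a)" for n i
    using that binomial_eq_0[of "n + i" "2 * i"] by fastforce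
  have "S 0 = (\<Sum>k\<le>0. of_nat ((0 + k) choose (2 * k)) * y ^ k)"
    unfolding S_def by (rule sum.mono_neutral_right) (use zero[of 0] in auto)
  then have S0: "S 0 = 1"
    by simp
  have "S 1 = (\<Sum>k\<le>1. of_nat ((1 + k) choose (2 * k)) * y ^ k)"
    unfolding S_def by (rule sum.mono_neutral_right) (use assms zero[of 1] in auto)
  then have S1: "S 1 = 1 + y"
    by (simp add: numeral_2_eq_2)
  have y2: "y + 2 = t + inverse t"
    by (simp add: y_def)
  \<comment> \<open>Shifting the index to \<open>Suc n\<close> avoids the truncated predecessor; a
    recurrence of order two needs two base cases.\<close>
  have "Suc n \<le> N \<Longrightarrow> t ^ Suc n + inverse t ^ Suc n = S (Suc n) + S n" for n
  proof (induction n rule: induct_nat_012)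
    case 0
    show ?case
      using S0 S1 y2 by (simp add: algebra_simps)
  next
    case 1
    then have "S (Suc (Suc 0)) = (y + 2) * S 1 - S 0"
      using rec[of 0] by (simp add: numeral_2_eq_2)
    then have "S (Suc (Suc 0)) + S (Suc 0) = (y + 2) ^ 2 - 2"
      using S0 S1 by (simp add: algebra_simps power2_eq_square)
    also have "\<dots> = t ^ Suc (Suc 0) + inverse t ^ Suc (Suc 0)"
      unfolding y2 using \<open>t \<noteq> 0\<close> by (simp add: power2_eq_square algebra_simps)
    finally show ?case ..
  next
    case (ge2 n)
    have "S (Suc (Suc (Suc n))) + S (Suc (Suc n)) =
        (y + 2) * (S (Suc (Suc n)) + S (Suc n)) - (S (Suc n) + S n)"
    proof -
      have "S (Suc (Suc n)) = (y + 2) * S (Suc n) - S n"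
        using rec[of n] ge2.prems by simp
      moreover have "S (Suc (Suc (Suc n))) = (y + 2) * S (Suc (Suc n)) - S (Suc n)"
        using rec[of "Suc n"] ge2.prems by simp
      ultimately show ?thesis
        by (simp only: right_diff_distrib distrib_left) simp
    qed
    also have "\<dots> = (t + inverse t) * (t ^ Suc (Suc n) + inverse t ^ Suc (Suc n))
        - (t ^ Suc n + inverse t ^ Suc n)"
      using ge2 y2 by simp
    also have "\<dots> = t ^ Suc (Suc (Suc n)) + inverse t ^ Suc (Suc (Suc n))"
      using \<open>t \<noteq> 0\<close> by (simp add: field_simps)
    finally show ?case ..
  qed
  from this[of "n - 1"] have "t ^ n + inverse t ^ n = S n + S (n - 1)"
    using assms by simp
  also have "\<dots> = (\<Sum>k\<le>N. (of_nat ((n + k) choose (2 * k)) + of_nat ((n - 1 + k) choose (2 * k))) * y ^ k)"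
    by (simp only: S_def sum.distrib distrib_right)
  finally show ?thesis
    by (simp only: y_def)
qed

text \<open>In the notation \<open>?a\<close>, \<open>?b\<close>, \<open>?c\<close> of the proof,
  absorption gives 2k b = (n + k) a and Pascal's rule gives b = a + c, so k (b + c) = 2k b - k a = n
  a. This produces the factor (j - i)/k of the final formula.\<close>

lemma binomial_sum_eq_quotient:
  assumes "1 \<le> k" and "1 \<le> n"
  shows "(of_nat ((n + k) choose (2 * k)) + of_nat ((n - 1 + k) choose (2 * k)) :: 'a::field_char_0) =
    of_nat n / of_nat k * of_nat ((n + k - 1) choose (2 * k - 1))"
proof -
  obtain k' where k: "k = Suc k'"
    using assms by (cases k) auto
  obtain n' where n: "n = Suc n'"
    using assms by (cases n) auto
  let ?N = "n' + k"
  have absorb: "2 * k * (Suc ?N choose (2 * k)) = Suc ?N * (?N choose (2 * k - 1))"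
    using binomial_absorption[of "2 * k - 1" "Suc ?N"] by (simp add: k)
  have pascal: "Suc ?N choose (2 * k) = (?N choose (2 * k - 1)) + (?N choose (2 * k))"
    using binomial_Suc_Suc[of ?N "2 * k - 1"] by (simp add: k)
  let ?a = "of_nat (?N choose (2 * k - 1)) :: 'a"
    and ?b = "of_nat (Suc ?N choose (2 * k)) :: 'a"
    and ?c = "of_nat (?N choose (2 * k)) :: 'a"
  have "of_nat (2 * k * (Suc ?N choose (2 * k))) = (of_nat (Suc ?N * (?N choose (2 * k - 1))) :: 'a)"
    using absorb by (simp only:)
  then have "2 * of_nat k * ?b = of_nat (n + k) * ?a"
    by (simp only: of_nat_mult n) simp
  moreover have "?b = ?a + ?c"
    by (simp only: pascal of_nat_add)
  ultimately have "of_nat k * (?b + ?c) = of_nat n * ?a"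
    by (simp add: algebra_simps)
  moreover have "of_nat k \<noteq> (0 :: 'a)"
    using assms by simp
  ultimately have "?b + ?c = of_nat n / of_nat k * ?a"
    by (simp add: field_simps)
  then show ?thesis
    by (simp add: n)
qed

section \<open>Closed form of the elementary symmetric functions\<close>

lemma sum_square_split_diagonal:
  fixes h :: "nat \<Rightarrow> nat \<Rightarrow> 'a::comm_monoid_add"
  shows "(\<Sum>i\<le>m. \<Sum>j\<le>m. h i j) = (\<Sum>i\<le>m. h i i) + (\<Sum>i\<le>m. \<Sum>j\<in>{i<..m}. h i j + h j i)"
proof (induction m)
  case 0
  then show ?case by simp
next
  case (Suc m)
  have "(\<Sum>i\<le>Suc m. \<Sum>j\<in>{i<..Suc m}. h i j + h j i) =
      (\<Sum>i\<le>m. (\<Sum>j\<in>{i<..m}. h i j + h j i) + (h i (Suc m) + h (Suc m) i))"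
  proof -
    have "{i<..Suc m} = insert (Suc m) {i<..m}" if "i \<le> m" for i
      using that by auto
    then show ?thesis
      by (simp add: add.commute)
  qed
  then show ?case
    using Suc by (simp add: sum.distrib add_ac)
qed

text \<open>The roots of Z^2 - w Z + 1 have sum w and product 1, so they are inverse to each other.
  Thus the substitution for x reaches every complex number.\<close>

lemma exists_plus_inverse_eq:
  fixes w :: complex
  obtains z where "z \<noteq> 0" and "z + inverse z = w"
proof -
  define z where "z = (w + csqrt (w\<^sup>2 - 4)) / 2"
  define z' where "z' = (w - csqrt (w\<^sup>2 - 4)) / 2"
  have "z * z' = (w\<^sup>2 - (csqrt (w\<^sup>2 - 4))\<^sup>2) / 4"
    by (simp add: z_def z'_def power2_eq_square algebra_simps)
  then have 1: "z * z' = 1"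
    by simp
  then have "z \<noteq> 0"
    by auto
  moreover from 1 have "inverse z = z'"
    by (rule inverse_unique)
  then have "z + inverse z = w"
    by (simp add: z_def z'_def field_simps)
  ultimately show thesis
    by (rule that)
qed

text \<open>Both identities are instances: p = b = q for A, and p = q^2, b = q for C. By the
  q-binomial theorem, \<open>u j\<close> is the coefficient of z^j in the product of the factors 1 +
  z b p^l over l < m.\<close>

lemma elementary_symmetric_closed_form:
  fixes p b s :: complex
  assumes p: "\<And>n. p ^ Suc n \<noteq> 1"
    and nz: "\<And>l. s * b * p ^ l \<noteq> 1"
    and s: "s = 1 \<or> s = -1"
    and k: "1 \<le> k" "k \<le> m"
  defines "u \<equiv> \<lambda>j. qbinomial p m j * p ^ (j choose 2) * b ^ j"
  shows "(\<Sum>ls\<in>increasing_tuples k m. \<Prod>l\<leftarrow>ls. b * p ^ (l - 1) / (1 - s * (b * p ^ (l - 1)))\<^sup>2) =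
    1 / (qpochhammer (s * b) p m)\<^sup>2 *
      (\<Sum>i=0..m-k. \<Sum>j=i+k..m. (- s) ^ (j - i - k) * (of_nat (j - i) / of_nat k) *
        of_nat ((j - i + k - 1) choose (2 * k - 1)) * (u i * u j))"
proof -
  define F where "F = (\<lambda>l. b * p ^ (l - 1) / (1 - s * (b * p ^ (l - 1)))\<^sup>2)"
  define E where "E = (\<lambda>k. \<Sum>ls\<in>increasing_tuples k m. \<Prod>l\<leftarrow>ls. F l)"
  define Q where "Q = qpochhammer (s * b) p m"
  define d :: "nat \<Rightarrow> nat \<Rightarrow> complex"
    where "d = (\<lambda>n k. of_nat ((n + k) choose (2 * k)) + of_nat ((n - 1 + k) choose (2 * k)))"
  \<comment> \<open>\<open>G n k\<close> is to be the coefficient of x^k in z^n + z^(-n), where x =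
    z + 1/z + 2s.\<close>
  define G where "G = (\<lambda>n k. (- s) ^ (n + k) * d n k)"
  have ss: "s * s = 1"
    using s by auto
  have s_inv: "inverse s = s"
    using s by auto
  have s_nz: "s \<noteq> 0"
    using s by auto
  have Q_nz: "Q \<noteq> 0"
    using nz by (auto simp: Q_def qpochhammer_def)
  have G: "z ^ n + inverse z ^ n = (\<Sum>k\<le>m. G n k * (z + inverse z + 2 * s) ^ k)"
    if "z \<noteq> 0" "1 \<le> n" "n \<le> m" for z n
  proof -
    \<comment> \<open>As s^2 = 1, this choice gives t + 1/t - 2 = -s x and z^n = (-s)^n t^n; hence
      the sign (-s)^(n+k) in \<open>G\<close>.\<close>
    define t where "t = - s * z"
    have "t \<noteq> 0"
      using that s_nz by (simp add: t_def)
    have t: "z = - s * t" "inverse z = - s * inverse t"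
      using ss s_inv by (simp_all add: t_def)
    have y: "t + inverse t - 2 = - s * (z + inverse z + 2 * s)"
      using s s_inv by (auto simp: t_def algebra_simps)
    have "z ^ n = (- s) ^ n * t ^ n" "inverse z ^ n = (- s) ^ n * inverse t ^ n"
      using t by (metis power_mult_distrib)+
    then have "z ^ n + inverse z ^ n = (- s) ^ n * (t ^ n + inverse t ^ n)"
      by (simp only: distrib_left)
    also have "t ^ n + inverse t ^ n = (\<Sum>k\<le>m. d n k * (t + inverse t - 2) ^ k)"
      unfolding d_def by (rule power_plus_inverse_power[OF \<open>t \<noteq> 0\<close> that(2,3)])
    finally show ?thesis
      unfolding y power_mult_distrib G_def sum_distrib_left power_add by (simp only: mult_ac)
  qed
  \<comment> \<open>The diagonal terms i = j are free of z, so they contribute only to the constant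
    coefficient, which k >= 1 excludes.\<close>
  define c where "c = (\<lambda>k. (if k = 0 then \<Sum>i\<le>m. u i * u i else 0) +
      (\<Sum>i\<le>m. \<Sum>j\<in>{i<..m}. u i * u j * G (j - i) k))"
  have "(\<Sum>k\<le>m. Q\<^sup>2 * E k * x ^ k) = (\<Sum>k\<le>m. c k * x ^ k)" for x
  proof -
    obtain z where z: "z \<noteq> 0" "z + inverse z = x - 2 * s"
      by (rule exists_plus_inverse_eq)
    then have x: "x = z + inverse z + 2 * s"
      by simp
    \<comment> \<open>The 2s in x cancels the cross term of (1 - s a)^2, leaving 1 + a^2 + (z + 1/z)
      a, which factors.\<close>
    have factor: "(1 - s * b * p ^ l)\<^sup>2 * (1 + x * F (Suc l)) =
        (1 + (z * b) * p ^ l) * (1 + (inverse z * b) * p ^ l)" for l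
    proof -
      define a where "a = b * p ^ l"
      have "1 - s * a \<noteq> 0"
        using nz[of l] by (simp add: a_def mult.assoc)
      then have "(1 - s * a)\<^sup>2 * (1 + x * (a / (1 - s * a)\<^sup>2)) = (1 - s * a)\<^sup>2 + x * a"
        by (simp add: distrib_left)
      also have "\<dots> = 1 + (s * s) * (a * a) + (z + inverse z) * a"
        by (simp add: x power2_eq_square algebra_simps)
      also have "\<dots> = (1 + z * a) * (1 + inverse z * a)"
        using z(1) by (simp add: ss algebra_simps)
      finally show ?thesis
        by (simp add: F_def a_def mult.assoc)
    qed
    have E_sum: "(\<Prod>l=1..m. 1 + x * F l) = (\<Sum>k\<le>m. E k * x ^ k)"
      by (simp only: prod_one_plus_increasing_tuples E_def)
    have "(\<Sum>k\<le>m. Q\<^sup>2 * E k * x ^ k) = Q\<^sup>2 * (\<Prod>l=1..m. 1 + x * F l)"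
      using E_sum by (simp only: sum_distrib_left mult.assoc)
    also have "(\<Prod>l=1..m. 1 + x * F l) = (\<Prod>l<m. 1 + x * F (Suc l))"
      by (rule prod.reindex_bij_witness[where i = Suc and j = "\<lambda>l. l - 1"]) auto
    also have "Q\<^sup>2 * \<dots> = (\<Prod>l<m. 1 + (z * b) * p ^ l) * (\<Prod>l<m. 1 + (inverse z * b) * p ^ l)"
      unfolding Q_def qpochhammer_def prod_power_distrib prod.distrib[symmetric] factor ..
    also have "\<dots> = (\<Sum>j\<le>m. u j * z ^ j) * (\<Sum>i\<le>m. u i * inverse z ^ i)"
      unfolding q_binomial_theorem[OF p] u_def power_mult_distrib by (simp only: mult_ac)
    also have "\<dots> = (\<Sum>i\<le>m. \<Sum>j\<le>m. u i * u j * (z ^ j * inverse z ^ i))"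
      unfolding sum_product by (subst sum.swap) (simp only: mult_ac)
    also have "\<dots> = (\<Sum>i\<le>m. u i * u i) +
        (\<Sum>i\<le>m. \<Sum>j\<in>{i<..m}. u i * u j * (z ^ (j - i) + inverse z ^ (j - i)))"
    proof -
      \<comment> \<open>The entries (i, j) and (j, i) carry the same weight and opposite powers of
        z, so together they give z^(j-i) + z^(-(j-i)).\<close>
      have "z ^ j * inverse z ^ i = z ^ (j - i)" "z ^ i * inverse z ^ j = inverse z ^ (j - i)"
        if "i \<le> j" for i j
        using that z(1) by (auto simp: power_diff power_inverse field_simps)
      then show ?thesis
        unfolding sum_square_split_diagonal
        by (intro arg_cong2[where f = "(+)"] sum.cong refl) (simp_all add: algebra_simps)
    qed
    also have "(\<Sum>i\<le>m. \<Sum>j\<in>{i<..m}. u i * u j * (z ^ (j - i) + inverse z ^ (j - i))) =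
        (\<Sum>i\<le>m. \<Sum>j\<in>{i<..m}. \<Sum>k\<le>m. u i * u j * G (j - i) k * x ^ k)"
      unfolding x by (intro sum.cong refl, subst G) (auto simp: z sum_distrib_left mult.assoc)
    also have "\<dots> = (\<Sum>k\<le>m. \<Sum>i\<le>m. \<Sum>j\<in>{i<..m}. u i * u j * G (j - i) k * x ^ k)"
      by (rule trans[OF sum.cong[OF refl sum.swap] sum.swap])
    also have "\<dots> = (\<Sum>k\<le>m. (\<Sum>i\<le>m. \<Sum>j\<in>{i<..m}. u i * u j * G (j - i) k) * x ^ k)"
      by (simp only: sum_distrib_right)
    also have "(\<Sum>i\<le>m. u i * u i) = (\<Sum>k\<le>m. (if k = 0 then \<Sum>i\<le>m. u i * u i else 0) * x ^ k)"
      by (simp add: if_distrib[of "\<lambda>a. a * _"] cong: if_cong)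
    finally show ?thesis
      by (simp only: c_def sum.distrib distrib_right)
  qed
  \<comment> \<open>Two polynomials in x that agree at every complex x have equal
    coefficients.\<close>
  then have "Q\<^sup>2 * E k = c k"
    using polyfun_eq_coeffs[of "\<lambda>k. Q\<^sup>2 * E k" m c] k by blast
  also have "c k = (\<Sum>i\<le>m. \<Sum>j\<in>{i<..m}. u i * u j * G (j - i) k)"
    using k by (simp add: c_def)
  \<comment> \<open>For 0 < j - i < k both binomial coefficients in \<open>d\<close> vanish.\<close>
  also have "\<dots> = (\<Sum>i\<le>m. \<Sum>j=i+k..m. u i * u j * G (j - i) k)"
  proof (rule sum.cong[OF refl], rule sum.mono_neutral_right, goal_cases)
    case (3 i)
    have "u i * u j * G (j - i) k = 0" if "j \<in> {i<..m} - {i+k..m}" for j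
    proof -
      have "j - i < k" "1 \<le> j - i"
        using that by auto
      then show ?thesis
        by (simp add: G_def d_def binomial_eq_0)
    qed
    then show ?case
      by blast
  qed (use k in auto)
  \<comment> \<open>For i > m - k the inner range is empty.\<close>
  also have "\<dots> = (\<Sum>i=0..m-k. \<Sum>j=i+k..m. u i * u j * G (j - i) k)"
    by (rule sum.mono_neutral_right) auto
  also have "\<dots> = (\<Sum>i=0..m-k. \<Sum>j=i+k..m. (- s) ^ (j - i - k) * (of_nat (j - i) / of_nat k) *
        of_nat ((j - i + k - 1) choose (2 * k - 1)) * (u i * u j))" (is "_ = ?R")
  proof (intro sum.cong refl)
    fix i j
    assume "j \<in> {i+k..m}"
    then have n: "1 \<le> j - i" "k \<le> j - i"
      using k by auto
    \<comment> \<open>The exponents n + k and n - k differ by the even number 2k, and (-s)^2 =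
      1.\<close>
    have "(- s) ^ (j - i + k) = (- s) ^ (j - i - k) * ((- s) * (- s)) ^ k"
      using n by (simp only: power_mult_distrib power_add[symmetric] add.assoc[symmetric]) simp
    then have "(- s) ^ (j - i + k) = (- s) ^ (j - i - k)"
      by (simp add: ss)
    then show "u i * u j * G (j - i) k = (- s) ^ (j - i - k) * (of_nat (j - i) / of_nat k) *
        of_nat ((j - i + k - 1) choose (2 * k - 1)) * (u i * u j)"
      unfolding G_def d_def binomial_sum_eq_quotient[OF k(1) n(1)] by (simp only: mult_ac)
  qed
  finally have "E k = 1 / Q\<^sup>2 * ?R"
    using Q_nz by (simp add: field_simps)
  then show ?thesis
    by (simp only: E_def F_def Q_def)
qed

section \<open>Specialization to the two MacMahon series\<close>

lemma power_neq_1: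
  fixes q :: "'a::real_normed_div_algebra"
  assumes "norm q < 1" and "0 < n"
  shows "q ^ n \<noteq> 1"
proof
  assume "q ^ n = 1"
  then have "norm q ^ n = 1"
    by (metis norm_one norm_power)
  moreover have "norm q ^ n < 1"
    using assms by (simp add: power_less_one_iff)
  ultimately show False
    by simp
qed

theorem theorem2p1:
  fixes q s :: complex and k m :: nat
  assumes "norm q < 1" and "1 \<le> k" and "k \<le> m"
    and "s = 1 \<or> s = -1"
  shows "macmahon_A s k m q =
           1 / (qpochhammer (s * q) q m)\<^sup>2 *
           (\<Sum>i=0..m-k. \<Sum>j=i+k..m.
              (- s) ^ (j - i - k) * (of_nat (j - i) / of_nat k) *
              of_nat ((j - i + k - 1) choose (2 * k - 1)) *
              qbinomial q m i * qbinomial q m j *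
              q ^ (i * (i + 1) div 2 + j * (j + 1) div 2))
       \<and> macmahon_C s k m q =
           1 / (qpochhammer (s * q) (q\<^sup>2) m)\<^sup>2 *
           (\<Sum>i=0..m-k. \<Sum>j=i+k..m.
              (- s) ^ (j - i - k) * (of_nat (j - i) / of_nat k) *
              of_nat ((j - i + k - 1) choose (2 * k - 1)) *
              qbinomial (q\<^sup>2) m i * qbinomial (q\<^sup>2) m j *
              q ^ (i\<^sup>2 + j\<^sup>2))"
proof
  \<comment> \<open>Since |s| = 1, the left side has modulus |q|^(l+1) < 1, so no denominator
    vanishes; even exponents cover the base q^2.\<close>
  have neq: "s * q * q ^ l \<noteq> 1" for l
  proof
    assume "s * q * q ^ l = 1"
    then have "norm (q ^ Suc l) = 1"
      using assms(4) by (metis (no_types) mult.assoc mult_1 mult_minus_left norm_minus_cancel norm_one power_Suc)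
    moreover have "norm (q ^ Suc l) < 1"
      using assms(1) by (simp add: norm_power power_less_one_iff del: power_Suc)
    ultimately show False
      by simp
  qed
  have q: "q ^ Suc n \<noteq> 1" and q2: "(q\<^sup>2) ^ Suc n \<noteq> 1" for n
    using power_neq_1[OF assms(1), of "Suc n"] power_neq_1[OF assms(1), of "2 * Suc n"]
    by (simp_all only: power_mult) simp_all
  have neq2: "s * q * (q\<^sup>2) ^ l \<noteq> 1" for l
    using neq[of "2 * l"] unfolding power_mult .
  let ?C = "\<lambda>i j. (- s) ^ (j - i - k) * (of_nat (j - i) / of_nat k) *
    of_nat ((j - i + k - 1) choose (2 * k - 1))"
  \<comment> \<open>This converts the exponents: halved it yields i(i+1)/2 for A, and as it stands
    it yields i^2 for C.\<close>
  have double_choose: "2 * (i choose 2) + i = i\<^sup>2" for i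
    by (cases i) (auto simp: choose_two power2_eq_square)
  show "macmahon_A s k m q =
           1 / (qpochhammer (s * q) q m)\<^sup>2 *
           (\<Sum>i=0..m-k. \<Sum>j=i+k..m.
              (- s) ^ (j - i - k) * (of_nat (j - i) / of_nat k) *
              of_nat ((j - i + k - 1) choose (2 * k - 1)) *
              qbinomial q m i * qbinomial q m j *
              q ^ (i * (i + 1) div 2 + j * (j + 1) div 2))"
  proof -
    have "q ^ sum_list ls / (\<Prod>l\<leftarrow>ls. (1 - s * q ^ l)\<^sup>2) =
        (\<Prod>l\<leftarrow>ls. q * q ^ (l - 1) / (1 - s * (q * q ^ (l - 1)))\<^sup>2)"
      if "\<forall>l\<in>set ls. 1 \<le> l" for ls :: "nat list"
      using that
    proof (induction ls)
      case (Cons l ls)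
      then have "q * q ^ (l - 1) = q ^ l"
        by (cases l) auto
      moreover have "q ^ sum_list ls / (\<Prod>l\<leftarrow>ls. (1 - s * q ^ l)\<^sup>2) =
          (\<Prod>l\<leftarrow>ls. q * q ^ (l - 1) / (1 - s * (q * q ^ (l - 1)))\<^sup>2)"
        using Cons by simp
      ultimately show ?case
        by (simp only: list.map prod_list.Cons sum_list.Cons power_add flip: times_divide_times_eq)
    qed simp
    then have A: "macmahon_A s k m q = (\<Sum>ls\<in>increasing_tuples k m.
        \<Prod>l\<leftarrow>ls. q * q ^ (l - 1) / (1 - s * (q * q ^ (l - 1)))\<^sup>2)"
      unfolding macmahon_A_def by (intro sum.cong refl) (auto simp: increasing_tuples_def)
    have "(i choose 2) + i = i * (i + 1) div 2" for i
      using double_choose[of i] by (simp add: power2_eq_square)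
    then have pow: "q ^ (i choose 2) * q ^ i = q ^ (i * (i + 1) div 2)" for i
      by (simp only: power_add[symmetric])
    have "?C i j * (qbinomial q m i * q ^ (i choose 2) * q ^ i *
          (qbinomial q m j * q ^ (j choose 2) * q ^ j)) =
        ?C i j * qbinomial q m i * qbinomial q m j * q ^ (i * (i + 1) div 2 + j * (j + 1) div 2)" for i j
      unfolding power_add pow[symmetric] by (simp only: mult_ac)
    with A show ?thesis
      by (simp only: elementary_symmetric_closed_form[OF q neq assms(4,2,3)])
  qed
  show "macmahon_C s k m q =
           1 / (qpochhammer (s * q) (q\<^sup>2) m)\<^sup>2 *
           (\<Sum>i=0..m-k. \<Sum>j=i+k..m.
              (- s) ^ (j - i - k) * (of_nat (j - i) / of_nat k) *
              of_nat ((j - i + k - 1) choose (2 * k - 1)) *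
              qbinomial (q\<^sup>2) m i * qbinomial (q\<^sup>2) m j *
              q ^ (i\<^sup>2 + j\<^sup>2))"
  proof -
    \<comment> \<open>The length bound is carried through the induction so that the natural-number
      subtraction never truncates and each entry splits off the exponent 2l - 1.\<close>
    have "length ls \<le> (\<Sum>l\<leftarrow>ls. 2 * l) \<and>
        q ^ ((\<Sum>l\<leftarrow>ls. 2 * l) - length ls) / (\<Prod>l\<leftarrow>ls. (1 - s * q ^ (2 * l - 1))\<^sup>2) =
        (\<Prod>l\<leftarrow>ls. q * (q\<^sup>2) ^ (l - 1) / (1 - s * (q * (q\<^sup>2) ^ (l - 1)))\<^sup>2)"
      if "\<forall>l\<in>set ls. 1 \<le> l" for ls :: "nat list"
      using that
    proof (induction ls)
      case (Cons l ls)
      then have l: "q * (q\<^sup>2) ^ (l - 1) = q ^ (2 * l - 1)"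
        by (cases l) (auto simp: power_mult[symmetric])
      have IH: "length ls \<le> (\<Sum>l\<leftarrow>ls. 2 * l)"
        using Cons by simp
      have "1 \<le> l"
        using Cons.prems by simp
      then have e: "(\<Sum>l\<leftarrow>l # ls. 2 * l) - length (l # ls) = (2 * l - 1) + ((\<Sum>l\<leftarrow>ls. 2 * l) - length ls)"
        using IH by simp
      have "q ^ ((\<Sum>l\<leftarrow>ls. 2 * l) - length ls) / (\<Prod>l\<leftarrow>ls. (1 - s * q ^ (2 * l - 1))\<^sup>2) =
          (\<Prod>l\<leftarrow>ls. q * (q\<^sup>2) ^ (l - 1) / (1 - s * (q * (q\<^sup>2) ^ (l - 1)))\<^sup>2)"
        using Cons by simp
      then have "q ^ ((\<Sum>l\<leftarrow>l # ls. 2 * l) - length (l # ls)) /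
          (\<Prod>l\<leftarrow>l # ls. (1 - s * q ^ (2 * l - 1))\<^sup>2) =
          (\<Prod>l\<leftarrow>l # ls. q * (q\<^sup>2) ^ (l - 1) / (1 - s * (q * (q\<^sup>2) ^ (l - 1)))\<^sup>2)"
        unfolding e by (simp only: l list.map prod_list.Cons power_add flip: times_divide_times_eq)
      then show ?case
        using IH \<open>1 \<le> l\<close> by simp
    qed simp
    then have "macmahon_C s k m q = (\<Sum>ls\<in>increasing_tuples k m.
        \<Prod>l\<leftarrow>ls. q * (q\<^sup>2) ^ (l - 1) / (1 - s * (q * (q\<^sup>2) ^ (l - 1)))\<^sup>2)"
      unfolding macmahon_C_def by (intro sum.cong refl) (auto simp: increasing_tuples_def)
    moreover have pow: "(q\<^sup>2) ^ (i choose 2) * q ^ i = q ^ i\<^sup>2" for i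
      by (simp only: power_mult[symmetric] power_add[symmetric] double_choose)
    moreover have "?C i j * (qbinomial (q\<^sup>2) m i * (q\<^sup>2) ^ (i choose 2) * q ^ i *
          (qbinomial (q\<^sup>2) m j * (q\<^sup>2) ^ (j choose 2) * q ^ j)) =
        ?C i j * qbinomial (q\<^sup>2) m i * qbinomial (q\<^sup>2) m j * q ^ (i\<^sup>2 + j\<^sup>2)" for i j
      unfolding power_add pow[symmetric] by (simp only: mult_ac)
    ultimately show ?thesis
      by (simp only: elementary_symmetric_closed_form[OF q2 neq2 assms(4,2,3)])
  qed
qed

end
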